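(* Let $p\in\mathbb{R}\setminus\{0,1\}$, $\epsilon\in\{0,1\}$, and let $\gamma_a$ be a convex $p$-elastic curve in $\mathbb{H}_\epsilon^2$ with nonconstant periodic curvature, where $a\in\mathbb{R}$ denotes the associated constant of integration. Then $\gamma_a$ is a space-like curve ($\epsilon_1=1$), $$0>a>a_*:=-\left((-1)^\epsilon p\right)^p\left((-1)^\epsilon (p-1)\right)^{1-p},$$ and: (i) If $\gamma_a\subset\mathbb{H}_0^2$ (i.e. $\epsilon=0$), then $p>1$ holds. (ii) If $\gamma_a\subset\mathbb{H}_1^2$ (i.e. $\epsilon=1$), then $p<0$ holds. In both cases, the momentum $\vec\xi\in\mathbb{L}^3$ of $\gamma_a$ is a time-like vector, i.e., $\langle\vec\xi,\vec\xi\rangle=a<0$.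
   Context: $\mathbb{L}^3$ is $\mathbb{R}^3$ with the metric $\langle\cdot,\cdot\rangle=dx^2+dy^2-dz^2$. The hyperbolic plane is $\mathbb{H}_0^2=\{x^2+y^2-z^2=-1,\ z>0\}$ and the de Sitter $2$-space is $\mathbb{H}_1^2=\{x^2+y^2-z^2=1\}$, each with the metric induced from $\mathbb{L}^3$ (Riemannian for $\epsilon=0$, Lorentzian for $\epsilon=1$) and Levi-Civita connection $\nabla$. Curves: All curves $\gamma:I\subseteq\mathbb{R}\to\mathbb{H}_\epsilon^2$ are smooth, immersed, non-null with constant causal character, and parameterized by arc length $s$; $(\cdot)'=d/ds$. Let $T=\gamma'$ and let $N$ be the unit normal such that $\{T,N\}$ is a positively oriented frame along $\gamma$ of the tangent bundle of $\mathbb{H}^2_\epsilon$; put $\epsilon_1=\langle T,T\rangle=\pm1$, $\epsilon_2=\langle N,N\rangle=\pm1$, so $\epsilon_1\epsilon_2=(-1)^\epsilon$ (and $\epsilon_1=\epsilon_2=1$ if $\epsilon=0$). The curve is space-like if $\epsilon_1=1$ and time-like if $\epsilon_1=-1$. The curvature $\kappa$ is defined by $\nabla_TT=\epsilon_2\kappa N$, $\nabla_TN=-\epsilon_1\kappa T$. A curve is convex if $\kappa>0$ everywhere. A $p$-elastic curve is a curve whose curvature satisfies $$p\,\frac{d^2}{ds^2}\left(\kappa^{p-1}\right)+\epsilon_1\epsilon_2(p-1)\kappa^{p+1}-\epsilon_2 p\,\kappa^{p-1}=0 .$$ For a $p$-elastic curve with nonconstant curvature there is a constant $a\in\mathbb{R}$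 (the constant of integration) such that $$p^2(p-1)^2\kappa^{2(p-2)}(\kappa')^2+\epsilon_1\epsilon_2(p-1)^2\kappa^{2p}-\epsilon_2p^2\kappa^{2(p-1)}=a ;$$ $\gamma_a$ denotes a $p$-elastic curve whose curvature satisfies this with constant $a$. The momentum of a $p$-elastic curve is $$\vec\xi:=p\,\kappa^{p-1}\gamma+p\,\frac{d}{ds}\left(\kappa^{p-1}\right)\gamma'+(1-p)\kappa^p\,\gamma\times\gamma'\in\mathbb{L}^3,$$ where $\times$ is the vector cross product of $\mathbb{L}^3$, i.e. $\langle u\times v,w\rangle=\det(u,v,w)$. *)

theory Defs
  imports "HOL-Analysis.Analysis"
begin

section \<open>Lorentz-Minkowski 3-space\<close>

definition lprod :: "real^3 \<Rightarrow> real^3 \<Rightarrow> real" where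
  "lprod u v = u$1 * v$1 + u$2 * v$2 - u$3 * v$3"

definition timelike :: "real^3 \<Rightarrow> bool" where
  "timelike v \<longleftrightarrow> lprod v v < 0"

definition lcross :: "real^3 \<Rightarrow> real^3 \<Rightarrow> real^3" where
  "lcross u v = vector [u$2 * v$3 - u$3 * v$2,
                        u$3 * v$1 - u$1 * v$3,
                        - (u$1 * v$2 - u$2 * v$1)]"

lemma lprod_lcross: "lprod (lcross u v) w = det (vector [u, v, w] :: real^3^3)"
  by (simp add: lprod_def lcross_def det_3 algebra_simps)

definition hyperquadric :: "nat \<Rightarrow> (real^3) set" where
  "hyperquadric \<epsilon> = (if \<epsilon> = 0 then {x. lprod x x = -1 \<and> x$3 > 0} else {x. lprod x x = 1})"


section \<open>Curves\<close>

abbreviation ddt :: "(real \<Rightarrow> real^3) \<Rightarrow> real \<Rightarrow> real^3" where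
  "ddt V s \<equiv> vector_derivative V (at s)"

definition smooth_curve_on :: "real set \<Rightarrow> (real \<Rightarrow> real^3) \<Rightarrow> bool" where
  "smooth_curve_on I \<gamma> \<longleftrightarrow> (\<forall>n. \<forall>s\<in>I. (ddt ^^ n) \<gamma> differentiable (at s))"

text \<open>The condition on \<^term>\<open>\<epsilon>\<^sub>1\<close> comprises being immersed, non-null, of constant causal
  character and parameterized by arc length.\<close>

definition arclength_curve :: "nat \<Rightarrow> real \<Rightarrow> real set \<Rightarrow> (real \<Rightarrow> real^3) \<Rightarrow> bool" where
  "arclength_curve \<epsilon> \<epsilon>\<^sub>1 I \<gamma> \<longleftrightarrow>
     open I \<and> is_interval I \<and> smooth_curve_on I \<gamma> \<and> \<gamma> ` I \<subseteq> hyperquadric \<epsilon> \<and>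
     (\<epsilon>\<^sub>1 = 1 \<or> \<epsilon>\<^sub>1 = -1) \<and> (\<forall>s\<in>I. lprod (ddt \<gamma> s) (ddt \<gamma> s) = \<epsilon>\<^sub>1)"

text \<open>The tangent plane of the hyperquadric at a point \<open>x\<close> is the Lorentz-orthogonal complement
  of \<open>x\<close>, and it is oriented by taking a basis \<open>(v, w)\<close> to be positive iff \<open>det (x, v, w) > 0\<close>.\<close>

definition oriented_unit_normal ::
    "real \<Rightarrow> real set \<Rightarrow> (real \<Rightarrow> real^3) \<Rightarrow> (real \<Rightarrow> real^3) \<Rightarrow> bool" where
  "oriented_unit_normal \<epsilon>\<^sub>2 I \<gamma> N \<longleftrightarrow>
     (\<epsilon>\<^sub>2 = 1 \<or> \<epsilon>\<^sub>2 = -1) \<and>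
     (\<forall>s\<in>I. lprod (N s) (\<gamma> s) = 0 \<and> lprod (N s) (ddt \<gamma> s) = 0 \<and> lprod (N s) (N s) = \<epsilon>\<^sub>2 \<and>
            det (vector [\<gamma> s, ddt \<gamma> s, N s] :: real^3^3) > 0)"

text \<open>The Levi-Civita connection of the metric induced on the hyperquadric, along \<open>\<gamma>\<close>: by the
  Gauss formula it is the tangential part of the flat derivative, and the normal line of the
  hyperquadric at \<open>\<gamma> s\<close> is spanned by \<open>\<gamma> s\<close> itself.\<close>

definition cov_deriv :: "(real \<Rightarrow> real^3) \<Rightarrow> (real \<Rightarrow> real^3) \<Rightarrow> real \<Rightarrow> real^3" where
  "cov_deriv \<gamma> V s =
     ddt V s - (lprod (ddt V s) (\<gamma> s) / lprod (\<gamma> s) (\<gamma> s)) *\<^sub>R \<gamma> s"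

definition has_curvature ::
    "real \<Rightarrow> real \<Rightarrow> real set \<Rightarrow> (real \<Rightarrow> real^3) \<Rightarrow> (real \<Rightarrow> real^3) \<Rightarrow> (real \<Rightarrow> real) \<Rightarrow> bool" where
  "has_curvature \<epsilon>\<^sub>1 \<epsilon>\<^sub>2 I \<gamma> N \<kappa> \<longleftrightarrow>
     (\<forall>s\<in>I. cov_deriv \<gamma> (ddt \<gamma>) s = (\<epsilon>\<^sub>2 * \<kappa> s) *\<^sub>R N s \<and>
            cov_deriv \<gamma> N s = (- \<epsilon>\<^sub>1 * \<kappa> s) *\<^sub>R ddt \<gamma> s)"

definition convex_curvature :: "real set \<Rightarrow> (real \<Rightarrow> real) \<Rightarrow> bool" where
  "convex_curvature I \<kappa> \<longleftrightarrow> (\<forall>s\<in>I. \<kappa> s > 0)"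

definition periodic_on :: "real set \<Rightarrow> (real \<Rightarrow> real) \<Rightarrow> bool" where
  "periodic_on I f \<longleftrightarrow> (\<exists>\<omega>>0. \<forall>s\<in>I. s + \<omega> \<in> I \<and> f (s + \<omega>) = f s)"


section \<open>Elastic curves\<close>

text \<open>Powers of the curvature with real exponent are \<open>powr\<close>, which is meaningful where \<open>\<kappa> > 0\<close>.\<close>

definition p_elastic :: "real \<Rightarrow> real \<Rightarrow> real \<Rightarrow> real set \<Rightarrow> (real \<Rightarrow> real) \<Rightarrow> bool" where
  "p_elastic p \<epsilon>\<^sub>1 \<epsilon>\<^sub>2 I \<kappa> \<longleftrightarrow>
     (\<forall>s\<in>I. p * deriv (deriv (\<lambda>t. \<kappa> t powr (p - 1))) s
            + \<epsilon>\<^sub>1 * \<epsilon>\<^sub>2 * (p - 1) * \<kappa> s powr (p + 1) - \<epsilon>\<^sub>2 * p * \<kappa> s powr (p - 1) = 0)"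

definition integration_constant ::
    "real \<Rightarrow> real \<Rightarrow> real \<Rightarrow> real set \<Rightarrow> (real \<Rightarrow> real) \<Rightarrow> real \<Rightarrow> bool" where
  "integration_constant p \<epsilon>\<^sub>1 \<epsilon>\<^sub>2 I \<kappa> a \<longleftrightarrow>
     (\<forall>s\<in>I. p^2 * (p - 1)^2 * \<kappa> s powr (2 * (p - 2)) * (deriv \<kappa> s)^2
            + \<epsilon>\<^sub>1 * \<epsilon>\<^sub>2 * (p - 1)^2 * \<kappa> s powr (2 * p)
            - \<epsilon>\<^sub>2 * p^2 * \<kappa> s powr (2 * (p - 1)) = a)"

definition a_star :: "nat \<Rightarrow> real \<Rightarrow> real" where
  "a_star \<epsilon> p = - (((-1)^\<epsilon> * p) powr p * ((-1)^\<epsilon> * (p - 1)) powr (1 - p))"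

definition momentum :: "real \<Rightarrow> (real \<Rightarrow> real^3) \<Rightarrow> (real \<Rightarrow> real) \<Rightarrow> real \<Rightarrow> real^3" where
  "momentum p \<gamma> \<kappa> s =
     (p * \<kappa> s powr (p - 1)) *\<^sub>R \<gamma> s
     + (p * deriv (\<lambda>t. \<kappa> t powr (p - 1)) s) *\<^sub>R ddt \<gamma> s
     + ((1 - p) * \<kappa> s powr p) *\<^sub>R lcross (\<gamma> s) (ddt \<gamma> s)"

end

theory Submission imports Defs begin

text \<open>The first integral is an energy balance: it has the form
  \<open>(non-negative kinetic term) + W \<kappa> = a\<close>, where \<open>W\<close> is an effective potential that depends only
  on the value of the curvature.  A nonconstant periodic curvature attains a minimum \<open>m\<close> and a
  larger maximum \<open>M\<close>; the kinetic term vanishes at both, so \<open>W m = W M = a\<close>, while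
  \<open>W \<le> a\<close> on the whole interval between them.  Hence the curvature is trapped in a potential well
  of \<open>W\<close>.

  The potential has at most one critical point \<open>c\<close> on the half-line of positive numbers, namely
  the solution of \<open>\<epsilon>\<^sub>1 (p - 1) c\<^sup>2 = p\<close>, and \<open>W'\<close> changes its sign there.  A well therefore needs two
  things (\<open>potential_well\<close>): the critical point exists, so \<open>\<epsilon>\<^sub>1 (p - 1)\<close> has the sign of \<open>p\<close>, and it
  is a minimum, so \<open>p \<epsilon>\<^sub>1 \<epsilon>\<^sub>2 > 0\<close>.  Together with \<open>\<epsilon>\<^sub>1 \<epsilon>\<^sub>2 = (-1)\<^sup>\<epsilon>\<close>, which is the signature of the
  ambient metric read off from an orthogonal frame, these two sign conditions force
  \<open>p < 0\<close> and \<open>\<epsilon>\<^sub>1 = 1\<close> in the de Sitter plane.  In the hyperbolic plane every tangent vector is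
  space-like (\<open>lprod_nonneg_orthogonal_timelike\<close>), and the two conditions read \<open>p > 1\<close>.  The constant \<open>a\<^sub>*\<close> is the depth \<open>W c\<close> of the well.
  Evaluating \<open>W\<close> at a turning point, \<open>m\<close> if \<open>\<epsilon> = 0\<close> and \<open>M\<close> if \<open>\<epsilon> = 1\<close>, gives \<open>a < 0\<close>
  (\<open>well_energy_negative\<close>).

  Finally, \<open>\<gamma>\<close>, \<open>\<gamma>'\<close> and \<open>\<gamma> \<times> \<gamma>'\<close> are mutually orthogonal, so the square of the momentum is a sum of
  three terms, and this sum is the left-hand side of the first integral.\<close>

section \<open>Orthogonal frames in Lorentz-Minkowski space\<close>

text \<open>The sign is opposite to that of Lagrange's identity in Euclidean space, because the metric
  has determinant \<open>-1\<close>.\<close>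

lemma lprod_lcross_self:
  "lprod (lcross u v) (lcross u v) = (lprod u v)\<^sup>2 - lprod u u * lprod v v"
  by (simp add: lprod_def lcross_def power2_eq_square algebra_simps)

lemma lprod_lcross_left: "lprod u (lcross u v) = 0"
  and lprod_lcross_right: "lprod v (lcross u v) = 0"
  by (simp_all add: lprod_def lcross_def algebra_simps)

text \<open>This is the determinant of the Gram matrix of an orthogonal triple: with \<open>J\<close> the matrix of
  the metric, it equals \<open>det J\<close> times the square of the determinant of the triple.\<close>

lemma det_square_orthogonal:
  fixes u v w :: "real^3"
  assumes "lprod u v = 0" and "lprod w u = 0" and "lprod w v = 0"
  shows "(det (vector [u, v, w] :: real^3^3))\<^sup>2 = - (lprod u u * lprod v v * lprod w w)"
proof -
  have "(det (vector [u, v, w] :: real^3^3))\<^sup>2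
      = - (lprod u u * lprod v v * lprod w w) - 2 * lprod u v * lprod w v * lprod w u
        + lprod u u * (lprod w v)\<^sup>2 + lprod v v * (lprod w u)\<^sup>2 + lprod w w * (lprod u v)\<^sup>2"
    unfolding det_3 lprod_def by (simp add: power2_eq_square algebra_simps)
  then show ?thesis using assms by simp
qed

text \<open>The induced metric of the hyperbolic plane is positive definite: by the Cauchy-Schwarz
  inequality in the horizontal plane, \<open>x\<^sub>3\<^sup>2 v\<^sub>3\<^sup>2 = (x\<^sub>1 v\<^sub>1 + x\<^sub>2 v\<^sub>2)\<^sup>2 \<le> (x\<^sub>3\<^sup>2 - 1) (v\<^sub>1\<^sup>2 + v\<^sub>2\<^sup>2)\<close>.\<close>

lemma lprod_nonneg_orthogonal_timelike:
  assumes x: "lprod x x = -1" and v: "lprod x v = 0"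
  shows "lprod v v \<ge> 0"
proof -
  let ?r = "(v$1)\<^sup>2 + (v$2)\<^sup>2"
  have h: "(x$1)\<^sup>2 + (x$2)\<^sup>2 = (x$3)\<^sup>2 - 1" and o: "x$1 * v$1 + x$2 * v$2 = x$3 * v$3"
    using x v by (simp_all add: lprod_def power2_eq_square)
  have "(x$3)\<^sup>2 * (v$3)\<^sup>2 = (x$1 * v$1 + x$2 * v$2)\<^sup>2"
    unfolding o by (simp add: power_mult_distrib)
  also have "\<dots> = ((x$1)\<^sup>2 + (x$2)\<^sup>2) * ?r - (x$1 * v$2 - x$2 * v$1)\<^sup>2"
    by (simp add: power2_eq_square algebra_simps)
  also have "\<dots> \<le> ((x$1)\<^sup>2 + (x$2)\<^sup>2) * ?r" by simp
  also have "\<dots> \<le> (x$3)\<^sup>2 * ?r"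
    unfolding h by (intro mult_right_mono) auto
  finally have "(x$3)\<^sup>2 * (v$3)\<^sup>2 \<le> (x$3)\<^sup>2 * ?r" .
  moreover have "(x$3)\<^sup>2 > 0"
    using h sum_power2_ge_zero[of "x$1" "x$2"] by linarith
  ultimately have "(v$3)\<^sup>2 \<le> ?r" by (simp only: mult_le_cancel_left_pos)
  then show ?thesis by (simp add: lprod_def power2_eq_square)
qed

lemma lprod_hyperquadric:
  assumes "\<epsilon> \<in> {0, 1}" and "x \<in> hyperquadric \<epsilon>"
  shows "lprod x x = - ((-1) ^ \<epsilon>)"
  using assms by (auto simp: hyperquadric_def)


section \<open>Frame and curvature of a unit-speed curve\<close>

lemma has_real_derivative_component:
  fixes V :: "real \<Rightarrow> real^3"
  assumes "V differentiable (at s)"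
  shows "((\<lambda>t. V t $ i) has_real_derivative ddt V s $ i) (at s)"
proof -
  have "(V has_vector_derivative ddt V s) (at s)"
    using assms by (simp add: vector_derivative_works)
  then have "((\<lambda>t. V t $ i) has_vector_derivative ddt V s $ i) (at s)"
    by (rule bounded_linear.has_vector_derivative[OF bounded_linear_vec_nth])
  then show ?thesis
    by (simp add: has_real_derivative_iff_has_vector_derivative)
qed

lemma arclength_curve_tangent_orthogonal:
  assumes "arclength_curve \<epsilon> \<epsilon>\<^sub>1 I \<gamma>" and "\<epsilon> \<in> {0, 1}" and s: "s \<in> I"
  shows "lprod (\<gamma> s) (ddt \<gamma> s) = 0"
proof -
  have op: "open I" and on: "\<gamma> ` I \<subseteq> hyperquadric \<epsilon>" and "(ddt ^^ 0) \<gamma> differentiable (at s)"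
    using assms unfolding arclength_curve_def smooth_curve_on_def by blast+
  then have d: "\<gamma> differentiable (at s)" by simp
  have D: "((\<lambda>t. lprod (\<gamma> t) (\<gamma> t)) has_real_derivative 2 * lprod (\<gamma> s) (ddt \<gamma> s)) (at s)"
    unfolding lprod_def
    by (rule derivative_eq_intros has_real_derivative_component[OF d] refl)+
       (simp add: algebra_simps)
  have "((\<lambda>t. lprod (\<gamma> t) (\<gamma> t)) has_real_derivative 0) (at s)"
  proof (rule has_field_derivative_transform_within_open[OF DERIV_const op s])
    show "- ((-1) ^ \<epsilon>) = lprod (\<gamma> t) (\<gamma> t)" if "t \<in> I" for t
      using lprod_hyperquadric[OF assms(2)] on that by auto
  qed
  from DERIV_unique[OF D this] show ?thesis by simp
qed

lemma oriented_frame: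
  assumes cur: "arclength_curve \<epsilon> \<epsilon>\<^sub>1 I \<gamma>" and \<epsilon>: "\<epsilon> \<in> {0, 1}"
    and nor: "oriented_unit_normal \<epsilon>\<^sub>2 I \<gamma> N" and s: "s \<in> I"
  shows "\<epsilon>\<^sub>1 * \<epsilon>\<^sub>2 = (-1) ^ \<epsilon>"
    and "det (vector [\<gamma> s, ddt \<gamma> s, N s] :: real^3^3) = 1"
proof -
  let ?d = "det (vector [\<gamma> s, ddt \<gamma> s, N s] :: real^3^3)"
  have g: "lprod (\<gamma> s) (\<gamma> s) = - ((-1) ^ \<epsilon>)"
    using cur s unfolding arclength_curve_def by (intro lprod_hyperquadric[OF \<epsilon>]) auto
  have T: "lprod (ddt \<gamma> s) (ddt \<gamma> s) = \<epsilon>\<^sub>1" "\<epsilon>\<^sub>1 = 1 \<or> \<epsilon>\<^sub>1 = -1"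
    using cur s unfolding arclength_curve_def by auto
  have N: "lprod (N s) (N s) = \<epsilon>\<^sub>2" "\<epsilon>\<^sub>2 = 1 \<or> \<epsilon>\<^sub>2 = -1" "lprod (N s) (\<gamma> s) = 0"
      "lprod (N s) (ddt \<gamma> s) = 0" and pos: "?d > 0"
    using nor s unfolding oriented_unit_normal_def by auto
  have sq: "?d\<^sup>2 = (-1) ^ \<epsilon> * \<epsilon>\<^sub>1 * \<epsilon>\<^sub>2"
    using det_square_orthogonal[OF arclength_curve_tangent_orthogonal[OF cur \<epsilon> s] N(3,4)] g T N
    by simp
  moreover have "?d\<^sup>2 > 0" using pos by simp
  ultimately show sign: "\<epsilon>\<^sub>1 * \<epsilon>\<^sub>2 = (-1) ^ \<epsilon>"
    using T(2) N(2) \<epsilon> by auto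
  have "?d\<^sup>2 = 1"
    using sq sign by (simp add: mult.assoc flip: power_add)
  then show "?d = 1"
    using pos by (simp add: power2_eq_1_iff)
qed

text \<open>The covariant derivative differs from \<open>\<gamma>''\<close> by a multiple of \<open>\<gamma>\<close>, which the determinant does
  not see.  Since the right-hand side involves only derivatives of \<open>\<gamma>\<close>, the curvature inherits
  differentiability from the curve.\<close>

lemma curvature_eq_det:
  assumes cur: "arclength_curve \<epsilon> \<epsilon>\<^sub>1 I \<gamma>" and \<epsilon>: "\<epsilon> \<in> {0, 1}"
    and nor: "oriented_unit_normal \<epsilon>\<^sub>2 I \<gamma> N" and curv: "has_curvature \<epsilon>\<^sub>1 \<epsilon>\<^sub>2 I \<gamma> N \<kappa>"
    and s: "s \<in> I"
  shows "\<kappa> s = \<epsilon>\<^sub>2 * det (vector [\<gamma> s, ddt \<gamma> s, ddt (ddt \<gamma>) s] :: real^3^3)"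
proof -
  define b where "b = lprod (ddt (ddt \<gamma>) s) (\<gamma> s) / lprod (\<gamma> s) (\<gamma> s)"
  have "ddt (ddt \<gamma>) s - b *\<^sub>R \<gamma> s = (\<epsilon>\<^sub>2 * \<kappa> s) *\<^sub>R N s"
    using curv s unfolding has_curvature_def cov_deriv_def b_def by blast
  then have "ddt (ddt \<gamma>) s = b *\<^sub>R \<gamma> s + (\<epsilon>\<^sub>2 * \<kappa> s) *\<^sub>R N s"
    by (simp add: algebra_simps)
  then have "det (vector [\<gamma> s, ddt \<gamma> s, ddt (ddt \<gamma>) s] :: real^3^3)
      = \<epsilon>\<^sub>2 * \<kappa> s * det (vector [\<gamma> s, ddt \<gamma> s, N s] :: real^3^3)"
    unfolding det_3 by (simp add: algebra_simps)
  moreover have "\<epsilon>\<^sub>2 * \<epsilon>\<^sub>2 = 1"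
    using nor unfolding oriented_unit_normal_def by auto
  ultimately show ?thesis
    using oriented_frame(2)[OF cur \<epsilon> nor s] by (simp flip: mult.assoc)
qed

lemma curvature_has_derivative:
  assumes cur: "arclength_curve \<epsilon> \<epsilon>\<^sub>1 I \<gamma>" and \<epsilon>: "\<epsilon> \<in> {0, 1}"
    and nor: "oriented_unit_normal \<epsilon>\<^sub>2 I \<gamma> N" and curv: "has_curvature \<epsilon>\<^sub>1 \<epsilon>\<^sub>2 I \<gamma> N \<kappa>"
    and s: "s \<in> I"
  shows "(\<kappa> has_real_derivative deriv \<kappa> s) (at s)"
proof -
  have "(ddt ^^ n) \<gamma> differentiable (at s)" for n
    using cur s unfolding arclength_curve_def smooth_curve_on_def by blast
  from this[of 0] this[of 1] this[of 2]
  have d: "\<gamma> differentiable (at s)" "ddt \<gamma> differentiable (at s)" "ddt (ddt \<gamma>) differentiable (at s)"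
    by (simp_all add: eval_nat_numeral)
  have "\<exists>D. ((\<lambda>t. \<epsilon>\<^sub>2 * det (vector [\<gamma> t, ddt \<gamma> t, ddt (ddt \<gamma>) t] :: real^3^3))
      has_real_derivative D) (at s)"
    unfolding det_3 vector_3
    by (rule exI, (rule derivative_intros d[THEN has_real_derivative_component])+)
  then obtain D where D: "((\<lambda>t. \<epsilon>\<^sub>2 * det (vector [\<gamma> t, ddt \<gamma> t, ddt (ddt \<gamma>) t] :: real^3^3))
      has_real_derivative D) (at s)" ..
  have op: "open I" using cur unfolding arclength_curve_def by blast
  have "(\<kappa> has_real_derivative D) (at s)"
    by (rule has_field_derivative_transform_within_open[OF D op s])
       (simp add: curvature_eq_det[OF cur \<epsilon> nor curv])
  then show ?thesis using DERIV_imp_deriv by blast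
qed


section \<open>Extrema of periodic functions\<close>

lemma periodic_iterate:
  fixes f :: "real \<Rightarrow> real"
  assumes "\<forall>s\<in>I. s + \<omega> \<in> I \<and> f (s + \<omega>) = f s" and "s \<in> I"
  shows "s + real n * \<omega> \<in> I \<and> f (s + real n * \<omega>) = f s"
proof (induction n)
  case (Suc n)
  have "s + real (Suc n) * \<omega> = s + real n * \<omega> + \<omega>" by (simp add: algebra_simps)
  then show ?case using Suc assms(1) by metis
qed (use assms(2) in simp)

text \<open>Periodicity only moves points of \<open>I\<close> to the right, so \<open>I\<close> may be a half-line.  Points to the
  left of the chosen period are shifted into it, and points to its right are shifts of points
  in it.\<close>

lemma continuous_periodic_attains_extrema:
  fixes f :: "real \<Rightarrow> real"
  assumes I: "is_interval I" "I \<noteq> {}" and cont: "continuous_on I f" and per: "periodic_on I f"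
  obtains l u where "l \<in> I" "u \<in> I" "\<And>t. t \<in> I \<Longrightarrow> f l \<le> f t \<and> f t \<le> f u"
proof -
  obtain \<omega> where \<omega>: "\<omega> > 0" and shift: "\<forall>s\<in>I. s + \<omega> \<in> I \<and> f (s + \<omega>) = f s"
    using per unfolding periodic_on_def by blast
  obtain s where s: "s \<in> I" using I(2) by blast
  let ?K = "{s..s + \<omega>}"
  have K: "?K \<subseteq> I"
    using I(1) s shift unfolding is_interval_1 by (meson atLeastAtMost_iff subsetI)
  have contK: "continuous_on ?K f" using cont K continuous_on_subset by blast
  have ne: "?K \<noteq> {}" using \<omega> by simp
  obtain l where l: "l \<in> ?K" "\<forall>t\<in>?K. f l \<le> f t"
    using continuous_attains_inf[OF compact_Icc ne contK] by blast
  obtain u where u: "u \<in> ?K" "\<forall>t\<in>?K. f t \<le> f u"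
    using continuous_attains_sup[OF compact_Icc ne contK] by blast
  have rep: "\<exists>r\<in>?K. f r = f t" if t: "t \<in> I" for t
  proof (cases "t \<ge> s")
    case True
    define n where "n = nat \<lfloor>(t - s) / \<omega>\<rfloor>"
    have "real n = of_int \<lfloor>(t - s) / \<omega>\<rfloor>"
      unfolding n_def using True \<omega> by simp
    then have "real n \<le> (t - s) / \<omega>" "(t - s) / \<omega> < real n + 1" by linarith+
    then have r: "t - real n * \<omega> \<in> ?K" using \<omega> by (auto simp: field_simps)
    then have "f (t - real n * \<omega> + real n * \<omega>) = f (t - real n * \<omega>)"
      using periodic_iterate[OF shift] K by blast
    then show ?thesis using r by auto
  next
    case False
    define n where "n = nat \<lceil>(s - t) / \<omega>\<rceil>"
    have "0 \<le> (s - t) / \<omega>" using False \<omega> by simp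
    then have "real n = of_int \<lceil>(s - t) / \<omega>\<rceil>"
      unfolding n_def by (simp add: order_trans[OF _ le_of_int_ceiling])
    then have "(s - t) / \<omega> \<le> real n" "real n < (s - t) / \<omega> + 1" by linarith+
    then have "t + real n * \<omega> \<in> ?K" using \<omega> by (auto simp: field_simps)
    then show ?thesis using periodic_iterate[OF shift t] by blast
  qed
  show ?thesis
  proof
    show "l \<in> I" "u \<in> I" using l(1) u(1) K by auto
    show "f l \<le> f t \<and> f t \<le> f u" if "t \<in> I" for t
      using rep[OF that] l(2) u(2) by auto
  qed
qed


section \<open>The effective potential\<close>

definition potential :: "real \<Rightarrow> real \<Rightarrow> real \<Rightarrow> real \<Rightarrow> real" where
  "potential p \<epsilon>\<^sub>1 \<epsilon>\<^sub>2 k =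
     \<epsilon>\<^sub>1 * \<epsilon>\<^sub>2 * (p - 1)^2 * k powr (2 * p) - \<epsilon>\<^sub>2 * p^2 * k powr (2 * (p - 1))"

lemma potential_eq:
  assumes "k > 0"
  shows "potential p \<epsilon>\<^sub>1 \<epsilon>\<^sub>2 k
    = \<epsilon>\<^sub>2 * k powr (2 * (p - 1)) * (\<epsilon>\<^sub>1 * (p - 1)^2 * k^2 - p^2)"
proof -
  have "k powr (2 * p) = k powr (2 * (p - 1)) * k^2"
    using assms powr_add[of k "2 * (p - 1)" 2] by (simp add: algebra_simps)
  then show ?thesis unfolding potential_def by (simp add: algebra_simps)
qed

lemma potential_has_derivative:
  assumes "k > 0"
  shows "(potential p \<epsilon>\<^sub>1 \<epsilon>\<^sub>2 has_real_derivative
      2 * p * (p - 1) * \<epsilon>\<^sub>2 * k powr (2 * p - 3) * (\<epsilon>\<^sub>1 * (p - 1) * k^2 - p)) (at k)"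
proof -
  have e: "k powr (2 * p - 1) = k powr (2 * p - 3) * k^2"
      "k powr (2 * (p - 1) - 1) = k powr (2 * p - 3)"
    using assms powr_add[of k "2 * p - 3" 2] by (simp_all add: algebra_simps)
  have "(potential p \<epsilon>\<^sub>1 \<epsilon>\<^sub>2 has_real_derivative
      \<epsilon>\<^sub>1 * \<epsilon>\<^sub>2 * (p - 1)^2 * ((2 * p) * k powr (2 * p - 1))
      - \<epsilon>\<^sub>2 * p^2 * ((2 * (p - 1)) * k powr (2 * (p - 1) - 1))) (at k)"
    unfolding potential_def[abs_def]
    by (intro DERIV_diff DERIV_cmult has_real_derivative_powr assms)
  then show ?thesis
    unfolding e by (simp add: power2_eq_square algebra_simps)
qed

text \<open>Rolle's theorem produces the critical point \<open>c\<close>.  Substituting its equation, \<open>W'\<close> has on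
  the interval from \<open>m\<close> to \<open>c\<close> the constant sign of \<open>- p \<epsilon>\<^sub>1 \<epsilon>\<^sub>2\<close>, and \<open>W c \<le> W m\<close> leaves only one
  possibility for it.\<close>

lemma potential_well:
  assumes p: "p \<noteq> 0" "p \<noteq> 1" and \<epsilon>\<^sub>1: "\<epsilon>\<^sub>1 \<noteq> 0" and \<epsilon>\<^sub>2: "\<epsilon>\<^sub>2 \<noteq> 0"
    and m: "0 < m" "m < M"
    and turn: "potential p \<epsilon>\<^sub>1 \<epsilon>\<^sub>2 m = a" "potential p \<epsilon>\<^sub>1 \<epsilon>\<^sub>2 M = a"
    and below: "\<And>k. m \<le> k \<Longrightarrow> k \<le> M \<Longrightarrow> potential p \<epsilon>\<^sub>1 \<epsilon>\<^sub>2 k \<le> a"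
  obtains c where "m < c" "c < M" "\<epsilon>\<^sub>1 * (p - 1) * c^2 = p" "p * \<epsilon>\<^sub>1 * \<epsilon>\<^sub>2 > 0"
    "potential p \<epsilon>\<^sub>1 \<epsilon>\<^sub>2 c < a"
proof -
  let ?W = "potential p \<epsilon>\<^sub>1 \<epsilon>\<^sub>2"
  let ?W' = "\<lambda>k. 2 * p * (p - 1) * \<epsilon>\<^sub>2 * k powr (2 * p - 3) * (\<epsilon>\<^sub>1 * (p - 1) * k^2 - p)"
  have D: "(?W has_real_derivative ?W' k) (at k)" if "m \<le> k" for k
    using potential_has_derivative m(1) that by simp
  have cont: "continuous_on {m..M} ?W"
    using D by (auto intro!: continuous_at_imp_continuous_on DERIV_isCont)
  obtain c where c: "m < c" "c < M" and "?W' c = 0"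
  proof -
    have "\<exists>c>m. c < M \<and> (\<lambda>x. ?W' c * x) = (\<lambda>x. 0)"
      by (rule Rolle_deriv[OF m(2) _ cont])
         (use turn D in \<open>auto simp: has_field_derivative_def\<close>)
    then obtain c where "m < c" "c < M" "(\<lambda>x. ?W' c * x) = (\<lambda>x. 0)" by blast
    moreover from fun_cong[OF this(3), of 1] have "?W' c = 0" by simp
    ultimately show ?thesis using that by blast
  qed
  then have crit: "\<epsilon>\<^sub>1 * (p - 1) * c^2 = p"
    using p \<epsilon>\<^sub>2 m by simp
  have W': "?W' k = p * \<epsilon>\<^sub>1 * \<epsilon>\<^sub>2 * (2 * (p - 1)^2 * k powr (2 * p - 3) * (k^2 - c^2))" for k
  proof -
    have "\<epsilon>\<^sub>1 * (p - 1) * k^2 - p = \<epsilon>\<^sub>1 * (p - 1) * (k^2 - c^2)"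
      using crit by (simp add: algebra_simps)
    then show ?thesis by (simp add: power2_eq_square)
  qed
  obtain z where z: "m < z" "z < c" and mvt: "?W c - ?W m = (c - m) * ?W' z"
    using MVT2[of m c ?W ?W'] D c by auto
  have "z\<^sup>2 < c\<^sup>2"
    using z m(1) by (intro power_strict_mono) auto
  then have neg: "(c - m) * (2 * (p - 1)^2 * z powr (2 * p - 3) * (z^2 - c^2)) < 0"
    using c z m p by (intro mult_pos_neg mult_pos_pos) auto
  have bal: "?W c - a = p * \<epsilon>\<^sub>1 * \<epsilon>\<^sub>2 * ((c - m) * (2 * (p - 1)^2 * z powr (2 * p - 3) * (z^2 - c^2)))"
    using mvt turn(1) unfolding W' by (simp add: mult.left_commute)
  have "p * \<epsilon>\<^sub>1 * \<epsilon>\<^sub>2 \<noteq> 0" using p(1) \<epsilon>\<^sub>1 \<epsilon>\<^sub>2 by simp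
  moreover have "\<not> p * \<epsilon>\<^sub>1 * \<epsilon>\<^sub>2 < 0"
    using bal below[of c] c mult_neg_neg[OF _ neg, of "p * \<epsilon>\<^sub>1 * \<epsilon>\<^sub>2"] by fastforce
  ultimately have pos: "p * \<epsilon>\<^sub>1 * \<epsilon>\<^sub>2 > 0" by linarith
  have "?W c < a" using bal mult_pos_neg[OF pos neg] by linarith
  with that c crit pos show ?thesis by blast
qed

text \<open>For \<open>\<sigma> = (-1)\<^sup>\<epsilon>\<close> the right-hand side is \<open>a\<^sub>*\<close>.  Since \<open>c\<^sup>2\<close> is the quotient of \<open>\<sigma> p\<close> and \<open>\<sigma> (p - 1)\<close>, which are both positive, all the powers
  below have positive bases.\<close>

lemma potential_at_critical_point:
  assumes c: "c > 0" "(p - 1) * c^2 = p" and \<sigma>: "\<sigma> * \<sigma> = 1" and pos: "\<sigma> * p > 0" "\<sigma> * (p - 1) > 0"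
  shows "potential p 1 \<sigma> c = - ((\<sigma> * p) powr p * (\<sigma> * (p - 1)) powr (1 - p))"
proof -
  have nz: "p \<noteq> 1" "\<sigma> \<noteq> 0" using pos by auto
  have c2: "c^2 = (\<sigma> * p) / (\<sigma> * (p - 1))"
    using c(2) nz by (simp add: field_simps)
  have "c powr (2 * (p - 1)) = (c^2) powr (p - 1)"
    using c(1) by (simp add: powr_powr flip: powr_numeral)
  also have "\<dots> = (\<sigma> * p) powr (p - 1) * (\<sigma> * (p - 1)) powr (1 - p)"
    unfolding c2 powr_divide
    using powr_minus_divide[of "\<sigma> * (p - 1)" "p - 1"] by simp
  finally have cp: "c powr (2 * (p - 1)) = (\<sigma> * p) powr (p - 1) * (\<sigma> * (p - 1)) powr (1 - p)" .
  have "(p - 1)^2 * c^2 - p^2 = (p - 1) * ((p - 1) * c^2) - p^2"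
    by (simp add: power2_eq_square)
  also have "\<dots> = - p" unfolding c(2) by (simp add: power2_eq_square algebra_simps)
  finally have "potential p 1 \<sigma> c = - ((\<sigma> * p) * c powr (2 * (p - 1)))"
    using potential_eq[OF c(1), of p 1 \<sigma>] by simp
  also have "(\<sigma> * p) * c powr (2 * (p - 1)) = (\<sigma> * p) powr p * (\<sigma> * (p - 1)) powr (1 - p)"
    unfolding cp using pos(1) powr_mult_base[of "\<sigma> * p" "p - 1"] by simp
  finally show ?thesis .
qed

text \<open>The potential has the sign of \<open>\<sigma> ((p - 1)\<^sup>2 k\<^sup>2 - p\<^sup>2)\<close>, and \<open>(p - 1)\<^sup>2 c\<^sup>2 - p\<^sup>2 = - p\<close>.  For
  \<open>\<sigma> = 1\<close>, where \<open>p > 0\<close>, moving from \<open>c\<close> to the smaller turning point \<open>m\<close> keeps the second factor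
  negative; for \<open>\<sigma> = -1\<close>, where \<open>p < 0\<close>, moving to the larger one \<open>M\<close> keeps it positive.\<close>

lemma well_energy_negative:
  assumes m: "0 < m" "m < c" "c < M" and crit: "(p - 1) * c^2 = p"
    and \<sigma>: "\<sigma> = 1 \<or> \<sigma> = -1" and pos: "\<sigma> * p > 0"
    and turn: "potential p 1 \<sigma> m = a" "potential p 1 \<sigma> M = a"
  shows "a < 0"
proof -
  have p1: "(p - 1)^2 > 0" using crit pos by auto
  have c: "(p - 1)^2 * c^2 - p^2 = - p"
  proof -
    have "(p - 1)^2 * c^2 - p^2 = (p - 1) * ((p - 1) * c^2) - p^2"
      by (simp add: power2_eq_square)
    then show ?thesis unfolding crit by (simp add: power2_eq_square algebra_simps)
  qed
  from \<sigma> show ?thesis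
  proof
    assume \<sigma>: "\<sigma> = 1"
    have "m^2 < c^2" using m by (intro power_strict_mono) auto
    then have "(p - 1)^2 * m^2 < (p - 1)^2 * c^2" using p1 by simp
    moreover have "p > 0" using pos \<sigma> by simp
    ultimately have "(p - 1)^2 * m^2 - p^2 < 0" using c by linarith
    then have "m powr (2 * (p - 1)) * ((p - 1)^2 * m^2 - p^2) < 0"
      using m by (intro mult_pos_neg) auto
    then show ?thesis using potential_eq[OF m(1), of p 1 \<sigma>] turn(1) \<sigma> by simp
  next
    assume \<sigma>: "\<sigma> = -1"
    have M: "M > 0" using m by simp
    have "c^2 < M^2" using m by (intro power_strict_mono) auto
    then have "(p - 1)^2 * c^2 < (p - 1)^2 * M^2" using p1 by simp
    moreover have "p < 0" using pos \<sigma> by simp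
    ultimately have "(p - 1)^2 * M^2 - p^2 > 0" using c by linarith
    then have "M powr (2 * (p - 1)) * ((p - 1)^2 * M^2 - p^2) > 0"
      using M by (intro mult_pos_pos) auto
    then show ?thesis using potential_eq[OF M, of p 1 \<sigma>] turn(2) \<sigma> by simp
  qed
qed


section \<open>The momentum\<close>

lemma lprod_orthogonal_combination:
  assumes "lprod u v = 0" and "lprod u w = 0" and "lprod v w = 0"
  shows "lprod (x *\<^sub>R u + y *\<^sub>R v + z *\<^sub>R w) (x *\<^sub>R u + y *\<^sub>R v + z *\<^sub>R w)
    = x^2 * lprod u u + y^2 * lprod v v + z^2 * lprod w w"
proof -
  have "lprod (x *\<^sub>R u + y *\<^sub>R v + z *\<^sub>R w) (x *\<^sub>R u + y *\<^sub>R v + z *\<^sub>R w)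
    = x^2 * lprod u u + y^2 * lprod v v + z^2 * lprod w w
      + 2 * x * y * lprod u v + 2 * x * z * lprod u w + 2 * y * z * lprod v w"
    by (simp add: lprod_def power2_eq_square algebra_simps)
  then show ?thesis using assms by simp
qed

text \<open>The squared lengths of \<open>\<gamma>\<close>, \<open>\<gamma>'\<close> and \<open>\<gamma> \<times> \<gamma>'\<close> are \<open>- \<epsilon>\<^sub>1 \<epsilon>\<^sub>2\<close>, \<open>\<epsilon>\<^sub>1\<close> and \<open>\<epsilon>\<^sub>2\<close>, which are \<open>\<epsilon>\<^sub>1\<close>
  times the signs \<open>- \<epsilon>\<^sub>2\<close>, \<open>1\<close> and \<open>\<epsilon>\<^sub>1 \<epsilon>\<^sub>2\<close> of the three terms of the first integral.\<close>

lemma lprod_momentum: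
  assumes cur: "arclength_curve \<epsilon> \<epsilon>\<^sub>1 I \<gamma>" and \<epsilon>: "\<epsilon> \<in> {0, 1}"
    and nor: "oriented_unit_normal \<epsilon>\<^sub>2 I \<gamma> N" and curv: "has_curvature \<epsilon>\<^sub>1 \<epsilon>\<^sub>2 I \<gamma> N \<kappa>"
    and conv: "convex_curvature I \<kappa>" and int: "integration_constant p \<epsilon>\<^sub>1 \<epsilon>\<^sub>2 I \<kappa> a" and s: "s \<in> I"
  shows "lprod (momentum p \<gamma> \<kappa> s) (momentum p \<gamma> \<kappa> s) = \<epsilon>\<^sub>1 * a"
proof -
  have k: "\<kappa> s > 0" using conv s unfolding convex_curvature_def by blast
  have orth: "lprod (\<gamma> s) (ddt \<gamma> s) = 0"
    by (rule arclength_curve_tangent_orthogonal[OF cur \<epsilon> s])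
  have sign: "\<epsilon>\<^sub>1 * \<epsilon>\<^sub>2 = (-1) ^ \<epsilon>" by (rule oriented_frame(1)[OF cur \<epsilon> nor s])
  have g: "lprod (\<gamma> s) (\<gamma> s) = - (\<epsilon>\<^sub>1 * \<epsilon>\<^sub>2)"
    unfolding sign using cur s unfolding arclength_curve_def
    by (intro lprod_hyperquadric[OF \<epsilon>]) auto
  have T: "lprod (ddt \<gamma> s) (ddt \<gamma> s) = \<epsilon>\<^sub>1" and e1: "\<epsilon>\<^sub>1 * \<epsilon>\<^sub>1 = 1"
    using cur s unfolding arclength_curve_def by auto
  have X: "lprod (lcross (\<gamma> s) (ddt \<gamma> s)) (lcross (\<gamma> s) (ddt \<gamma> s)) = \<epsilon>\<^sub>2"
    using lprod_lcross_self[of "\<gamma> s" "ddt \<gamma> s"] orth g T e1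
    by (simp add: mult.assoc mult.commute[of \<epsilon>\<^sub>2] flip: mult.assoc)
  have "((\<lambda>t. \<kappa> t powr (p - 1)) has_real_derivative
      (p - 1) * \<kappa> s powr (p - 1 - 1) * deriv \<kappa> s) (at s)"
    using DERIV_fun_powr[OF curvature_has_derivative[OF cur \<epsilon> nor curv s] k, of "p - 1"]
    by simp
  then have d: "deriv (\<lambda>t. \<kappa> t powr (p - 1)) s = (p - 1) * \<kappa> s powr (p - 2) * deriv \<kappa> s"
    by (simp add: DERIV_imp_deriv)
  have sq: "(\<kappa> s powr q)\<^sup>2 = \<kappa> s powr (2 * q)" for q
    using k by (simp add: power2_eq_square flip: powr_add)
  have "lprod (momentum p \<gamma> \<kappa> s) (momentum p \<gamma> \<kappa> s)
      = (p * \<kappa> s powr (p - 1))^2 * (- (\<epsilon>\<^sub>1 * \<epsilon>\<^sub>2))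
        + (p * ((p - 1) * \<kappa> s powr (p - 2) * deriv \<kappa> s))^2 * \<epsilon>\<^sub>1
        + ((1 - p) * \<kappa> s powr p)^2 * \<epsilon>\<^sub>2"
    unfolding momentum_def d
    using lprod_orthogonal_combination[OF orth lprod_lcross_left lprod_lcross_right] g T X by simp
  also have "\<dots> = \<epsilon>\<^sub>1 * (p^2 * (p - 1)^2 * \<kappa> s powr (2 * (p - 2)) * (deriv \<kappa> s)^2
      + \<epsilon>\<^sub>1 * \<epsilon>\<^sub>2 * (p - 1)^2 * \<kappa> s powr (2 * p) - \<epsilon>\<^sub>2 * p^2 * \<kappa> s powr (2 * (p - 1)))"
  proof -
    have "\<epsilon>\<^sub>1 * (\<epsilon>\<^sub>1 * y) = y" for y using e1 by (simp flip: mult.assoc)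
    then show ?thesis
      unfolding power_mult_distrib sq power2_commute[of 1 p] by (simp add: algebra_simps)
  qed
  also have "\<dots> = \<epsilon>\<^sub>1 * a"
    using int s unfolding integration_constant_def by simp
  finally show ?thesis .
qed


section \<open>Periodic p-elastic curves\<close>

text \<open>The extremal values of the curvature are turning points of the energy balance, and by the
  intermediate value theorem every value between them is a value of the curvature.\<close>

lemma periodic_curvature_turning_points:
  assumes op: "open I" and ival: "is_interval I"
    and D: "\<And>s. s \<in> I \<Longrightarrow> (\<kappa> has_real_derivative deriv \<kappa> s) (at s)"
    and conv: "convex_curvature I \<kappa>" and per: "periodic_on I \<kappa>" and nc: "\<not> \<kappa> constant_on I"
    and int: "integration_constant p \<epsilon>\<^sub>1 \<epsilon>\<^sub>2 I \<kappa> a"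
  obtains m M where "0 < m" "m < M" "potential p \<epsilon>\<^sub>1 \<epsilon>\<^sub>2 m = a" "potential p \<epsilon>\<^sub>1 \<epsilon>\<^sub>2 M = a"
    "\<And>k. m \<le> k \<Longrightarrow> k \<le> M \<Longrightarrow> potential p \<epsilon>\<^sub>1 \<epsilon>\<^sub>2 k \<le> a"
proof -
  have cont: "continuous_on I \<kappa>"
    using D by (auto intro!: continuous_at_imp_continuous_on DERIV_isCont)
  have "I \<noteq> {}" using nc by (auto simp: constant_on_def)
  then obtain l u where lu: "l \<in> I" "u \<in> I" and ext: "\<And>t. t \<in> I \<Longrightarrow> \<kappa> l \<le> \<kappa> t \<and> \<kappa> t \<le> \<kappa> u"
    using continuous_periodic_attains_extrema[OF ival _ cont per] by blast
  have energy: "(p * (p - 1) * \<kappa> s powr (p - 2) * deriv \<kappa> s)\<^sup>2 + potential p \<epsilon>\<^sub>1 \<epsilon>\<^sub>2 (\<kappa> s) = a"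
    if "s \<in> I" for s
  proof -
    have "\<kappa> s > 0" using conv that unfolding convex_curvature_def by blast
    then have "(\<kappa> s powr (p - 2))\<^sup>2 = \<kappa> s powr (2 * (p - 2))"
      by (simp add: power2_eq_square flip: powr_add)
    then show ?thesis
      using int that unfolding integration_constant_def potential_def power_mult_distrib by auto
  qed
  have crit: "deriv \<kappa> l = 0" "deriv \<kappa> u = 0"
  proof -
    obtain r where r: "r > 0" "\<forall>y. \<bar>l - y\<bar> < r \<longrightarrow> y \<in> I"
      using op lu(1) unfolding open_dist by (metis dist_commute dist_real_def)
    show "deriv \<kappa> l = 0"
      using DERIV_local_min[OF D[OF lu(1)] r(1)] r(2) ext by blast
    obtain r where r: "r > 0" "\<forall>y. \<bar>u - y\<bar> < r \<longrightarrow> y \<in> I"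
      using op lu(2) unfolding open_dist by (metis dist_commute dist_real_def)
    show "deriv \<kappa> u = 0"
      using DERIV_local_max[OF D[OF lu(2)] r(1)] r(2) ext by blast
  qed
  show ?thesis
  proof
    show "0 < \<kappa> l" using conv lu(1) unfolding convex_curvature_def by blast
    show "potential p \<epsilon>\<^sub>1 \<epsilon>\<^sub>2 (\<kappa> l) = a" "potential p \<epsilon>\<^sub>1 \<epsilon>\<^sub>2 (\<kappa> u) = a"
      using energy[OF lu(1)] energy[OF lu(2)] crit by simp_all
    show "\<kappa> l < \<kappa> u"
    proof (rule ccontr)
      assume "\<not> \<kappa> l < \<kappa> u"
      then have "\<kappa> t = \<kappa> l" if "t \<in> I" for t using ext[OF that] by linarith
      then show False using nc unfolding constant_on_def by blast
    qed
    show "potential p \<epsilon>\<^sub>1 \<epsilon>\<^sub>2 k \<le> a" if "\<kappa> l \<le> k" "k \<le> \<kappa> u" for k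
    proof -
      have "connected (\<kappa> ` I)"
        using connected_continuous_image[OF cont is_interval_connected[OF ival]] .
      then have "k \<in> \<kappa> ` I"
        using connected_contains_Icc[of "\<kappa> ` I" "\<kappa> l" "\<kappa> u"] lu that by auto
      then obtain s where "s \<in> I" "k = \<kappa> s" by blast
      then show ?thesis
        using energy[OF \<open>s \<in> I\<close>] zero_le_power2[of "p * (p - 1) * \<kappa> s powr (p - 2) * deriv \<kappa> s"]
        unfolding \<open>k = \<kappa> s\<close> by linarith
    qed
  qed
qed

theorem theorem4p1:
  fixes p a \<epsilon>\<^sub>1 \<epsilon>\<^sub>2 :: real and \<epsilon> :: nat and I :: "real set"
    and \<gamma> N :: "real \<Rightarrow> real^3" and \<kappa> :: "real \<Rightarrow> real"
  assumes "p \<noteq> 0" and "p \<noteq> 1" and "\<epsilon> \<in> {0, 1}"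
    and "arclength_curve \<epsilon> \<epsilon>\<^sub>1 I \<gamma>"
    and "oriented_unit_normal \<epsilon>\<^sub>2 I \<gamma> N"
    and "has_curvature \<epsilon>\<^sub>1 \<epsilon>\<^sub>2 I \<gamma> N \<kappa>"
    and "convex_curvature I \<kappa>"
    and "p_elastic p \<epsilon>\<^sub>1 \<epsilon>\<^sub>2 I \<kappa>"
    and "\<not> \<kappa> constant_on I"
    and "periodic_on I \<kappa>"
    and "integration_constant p \<epsilon>\<^sub>1 \<epsilon>\<^sub>2 I \<kappa> a"
  shows "\<epsilon>\<^sub>1 = 1 \<and> 0 > a \<and> a > a_star \<epsilon> p
    \<and> (\<epsilon> = 0 \<longrightarrow> p > 1)
    \<and> (\<epsilon> = 1 \<longrightarrow> p < 0)
    \<and> (\<forall>s\<in>I. timelike (momentum p \<gamma> \<kappa> s)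
             \<and> lprod (momentum p \<gamma> \<kappa> s) (momentum p \<gamma> \<kappa> s) = a)"
proof -
  note \<epsilon> = assms(3) and cur = assms(4) and nor = assms(5) and curv = assms(6)
  have I: "open I" "is_interval I" and e1: "\<epsilon>\<^sub>1 = 1 \<or> \<epsilon>\<^sub>1 = -1"
    using cur unfolding arclength_curve_def by auto
  have e2: "\<epsilon>\<^sub>2 = 1 \<or> \<epsilon>\<^sub>2 = -1"
    using nor unfolding oriented_unit_normal_def by auto
  obtain m M where m: "0 < m" "m < M"
    and turn: "potential p \<epsilon>\<^sub>1 \<epsilon>\<^sub>2 m = a" "potential p \<epsilon>\<^sub>1 \<epsilon>\<^sub>2 M = a"
    and below: "\<And>k. m \<le> k \<Longrightarrow> k \<le> M \<Longrightarrow> potential p \<epsilon>\<^sub>1 \<epsilon>\<^sub>2 k \<le> a"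
    using periodic_curvature_turning_points[OF I curvature_has_derivative[OF cur \<epsilon> nor curv]
        assms(7,10,9,11)] by blast
  obtain c where c: "m < c" "c < M" and crit: "\<epsilon>\<^sub>1 * (p - 1) * c^2 = p"
    and well: "p * \<epsilon>\<^sub>1 * \<epsilon>\<^sub>2 > 0" and depth: "potential p \<epsilon>\<^sub>1 \<epsilon>\<^sub>2 c < a"
    using potential_well[OF assms(1,2) _ _ m turn below] e1 e2
    by (metis neg_equal_0_iff_equal zero_neq_one)
  obtain s where s: "s \<in> I" using assms(9) by (auto simp: constant_on_def)
  have sign: "\<epsilon>\<^sub>1 * \<epsilon>\<^sub>2 = (-1) ^ \<epsilon>" by (rule oriented_frame(1)[OF cur \<epsilon> nor s])
  have c2: "c^2 > 0" using c m by simp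
  \<comment> \<open>The existence of the critical point and its being a minimum give one sign condition each.\<close>
  have same: "\<epsilon>\<^sub>1 * (p - 1) > 0 \<longleftrightarrow> p > 0" "\<epsilon>\<^sub>1 * (p - 1) < 0 \<longleftrightarrow> p < 0"
    using crit c2 by (metis zero_less_mult_pos2 mult_pos_pos, metis mult_less_0_iff not_less_iff_gr_or_eq)
  have ps: "p * (-1) ^ \<epsilon> > 0" using well unfolding sign[symmetric] by (simp add: mult.assoc)
  have hyp: "p > 1 \<and> \<epsilon>\<^sub>1 = 1" if "\<epsilon> = 0"
  proof -
    have "lprod (\<gamma> s) (\<gamma> s) = -1" "lprod (ddt \<gamma> s) (ddt \<gamma> s) = \<epsilon>\<^sub>1"
      using cur s that unfolding arclength_curve_def hyperquadric_def by auto
    then have "\<epsilon>\<^sub>1 \<ge> 0"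
      using lprod_nonneg_orthogonal_timelike arclength_curve_tangent_orthogonal[OF cur \<epsilon> s]
      by metis
    then show ?thesis using that ps same e1 by auto
  qed
  have dS: "p < 0 \<and> \<epsilon>\<^sub>1 = 1" if "\<epsilon> = 1"
    using that ps same e1 e2 sign by auto
  have e1: "\<epsilon>\<^sub>1 = 1" using hyp dS \<epsilon> by auto
  then have e2': "\<epsilon>\<^sub>2 = (-1) ^ \<epsilon>" using sign by simp
  have pos: "\<epsilon>\<^sub>2 * p > 0" "\<epsilon>\<^sub>2 * (p - 1) > 0"
    using hyp dS \<epsilon> unfolding e2' by auto
  have crit1: "(p - 1) * c^2 = p" using crit e1 by simp
  have "a < 0"
    using well_energy_negative[OF m(1) c crit1 e2 pos(1)] turn e1 by simp
  moreover have "a_star \<epsilon> p < a"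
    using potential_at_critical_point[OF _ crit1 _ pos] depth c m e1 e2
    unfolding a_star_def e2' by auto
  moreover have "lprod (momentum p \<gamma> \<kappa> t) (momentum p \<gamma> \<kappa> t) = a" if "t \<in> I" for t
    using lprod_momentum[OF cur \<epsilon> nor curv assms(7,11) that] e1 by simp
  ultimately show ?thesis using hyp dS e1 unfolding timelike_def by auto
qed

end
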